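(* Let $n\ge 1$. There exists a partition $\mathcal{U}_n=\bigcup_{C\in\mathcal{C}_n}C$ of the set $\mathcal U_n$ of embedded trees with $n$ edges into disjoint classes (called conjugacy classes), each of size at most $n+2$, such that for each class $C\in\mathcal{C}_n$: \begin{itemize} \item $2\cdot|C|=(n+2)\cdot|C\cap\mathcal{W}_n|$, where $\mathcal W_n\subset\mathcal U_n$ is the set of well labelled trees with $n$ edges; \item for any $W\in\mathcal{W}_n\cap C$, any $U\in C$ and any $k\geq1$, \[\widehat\Lambda_{k-2}(U)\;\leq\;\widehat\lambda_k(W)\;\leq\;\widehat\Lambda_{k+2}(U).\] \end{itemize}
   Context: A plane tree is a rooted planar map without cycles (equivalently, a rooted tree in which the children of each vertex are linearly ordered). An embedded tree (also called unconstrained well labelled tree) is a plane tree whose vertices carry integer labels such that the labels of any two adjacent vertices differ by at most $1$ (i.e. by $-1$, $0$ or $1$) and the label of the root vertex is $1$. $\mathcal U_n$ is the set of embedded trees with $n$ edges. A well labelled tree is an embedded tree all of whose labels are positive; $\mathcal W_n$ is the set of well labelled trees with $n$ edges. For a tree $T\in\mathcal U_n$ let $\lambda_k^{[T]}$ be the number of vertices of $T$ with label $k$. For $W\in\mathcal W_n$, the cumulated label distribution is $\widehat\lambda_k(W)=\sum_{\ell=1}^{k}\lambda_\ell^{[W]}$. For $U\in\mathcal U_n$ with minimal label $m$, the cumulated label distribution is taken relative to the minimum: $\widehat\Lambda_k(U)=\sum_{\ell=1}^k\lambda_{m+\ell-1}^{[U]}$. Empty sums (for $k\le 0$) are $0$.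 *)

theory Defs
  imports Main "HOL-Library.Disjoint_Sets"
begin

datatype ltree = Node (root_label: int) (children: "ltree list")

fun labels :: "ltree \<Rightarrow> int list" where
  "labels (Node a ts) = a # concat (map labels ts)"

fun num_edges :: "ltree \<Rightarrow> nat" where
  "num_edges (Node a ts) = (\<Sum>t\<leftarrow>ts. num_edges t + 1)"

fun adjacent_labels_close :: "ltree \<Rightarrow> bool" where
  "adjacent_labels_close (Node a ts) \<longleftrightarrow>
     (\<forall>t\<in>set ts. \<bar>root_label t - a\<bar> \<le> 1 \<and> adjacent_labels_close t)"

definition embedded_trees :: "nat \<Rightarrow> ltree set" where
  "embedded_trees n =
     {T. num_edges T = n \<and> root_label T = 1 \<and> adjacent_labels_close T}"

definition well_labelled_trees :: "nat \<Rightarrow> ltree set" where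
  "well_labelled_trees n = {T \<in> embedded_trees n. \<forall>x\<in>set (labels T). x > 0}"

definition label_count :: "ltree \<Rightarrow> int \<Rightarrow> nat" where
  "label_count T k = count_list (labels T) k"

definition min_label :: "ltree \<Rightarrow> int" where
  "min_label T = Min (set (labels T))"

text \<open>The index of both cumulated distributions is an integer, so that the sums
  are empty for all \<open>k \<le> 0\<close> and shifted indices such as \<open>k - 2\<close> do not truncate.\<close>

definition cum_labels :: "ltree \<Rightarrow> int \<Rightarrow> nat" where
  "cum_labels W k = (\<Sum>l=1..k. label_count W l)"

definition cum_labels_rel :: "ltree \<Rightarrow> int \<Rightarrow> nat" where
  "cum_labels_rel U k = (\<Sum>l=1..k. label_count U (min_label U + l - 1))"

end

theory Submission
  imports Defs "HOL-Library.Multiset"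
begin

text \<open>
  Embedded trees correspond to blossom trees: planted binary trees in which every inner node
  carries one bud. Walk around a blossom tree, going up by one at each bud and down by one at each
  leaf; the heights just before the leaves are the vertex labels of the embedded tree. Conjugacy is
  rerooting at another leaf, which rotates the cyclic sequence of buds and leaves. There are
  \<open>n\<close> buds and \<open>n + 2\<close> leaves (with the root), so the height drops by 2 in each period and
  exactly two leaves are strict records of the walk; these are the roots that yield well
  labelled trees. Rerooting a well labelled tree lowers by 2 the labels of the leaves preceding the
  new root and exchanges one leaf for another, which gives the comparison of the label distributions.
\<close>

section \<open>Cyclic orbits\<close>

lemma card_eq_sum_of_bool:
  fixes N :: nat
  shows "card {i. i < N \<and> P i} = (\<Sum>i<N. of_bool (P i))"
proof -
  have "{i. i < N \<and> P i} = {..<N} \<inter> {i. P i}"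
    by auto
  then show ?thesis
    by simp
qed

text \<open>Passing from \<open>x\<close> to \<open>f x\<close> drops index 0 and adds index
  \<open>N\<close>, and both carry the point \<open>x\<close>.\<close>

lemma card_funpow_shift:
  assumes "(f ^^ N) x = x"
  shows "card {i. i < N \<and> P ((f ^^ i) (f x))} = card {i. i < N \<and> P ((f ^^ i) x)}"
proof -
  have "(\<Sum>i<N. of_bool (P ((f ^^ Suc i) x))) + of_bool (P x)
      = (\<Sum>i<Suc N. of_bool (P ((f ^^ i) x)) :: nat)"
    by (subst sum.lessThan_Suc_shift) simp
  also have "\<dots> = (\<Sum>i<N. of_bool (P ((f ^^ i) x))) + of_bool (P x)"
    using assms by simp
  finally show ?thesis
    by (simp add: card_eq_sum_of_bool funpow_swap1)
qed

lemma funpow_commute: "(f ^^ m) ((f ^^ n) x) = (f ^^ n) ((f ^^ m) x)"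
  using fun_cong[OF funpow_add[of m n f], of x] fun_cong[OF funpow_add[of n m f], of x]
  by (simp add: add.commute)

lemma funpow_cycle:
  assumes "(f ^^ N) x = x"
  shows "(f ^^ N) ((f ^^ j) x) = (f ^^ j) x"
  using funpow_commute[of N f j x] assms by simp

lemma card_funpow_shifts:
  assumes "(f ^^ N) x = x"
  shows "card {i. i < N \<and> P ((f ^^ i) ((f ^^ j) x))} = card {i. i < N \<and> P ((f ^^ i) x)}"
proof (induction j)
  case (Suc j)
  then show ?case
    using card_funpow_shift[OF funpow_cycle[OF assms, of j], of P] by simp
qed simp

text \<open>All points of the orbit are visited equally often below \<open>N\<close>, namely as
  often as \<open>x\<close> itself, so counts of indices and counts of points are proportional. This
  covers symmetric trees, whose classes have fewer than \<open>N\<close> elements.\<close>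

lemma card_orbit:
  fixes f :: "'a \<Rightarrow> 'a"
  assumes cycle: "(f ^^ N) x = x"
  defines "O' \<equiv> (\<lambda>i. (f ^^ i) x) ` {..<N}"
  shows "card {i. i < N \<and> P ((f ^^ i) x)} * card O' = N * card {y \<in> O'. P y}"
proof -
  define s where "s = card {i. i < N \<and> (f ^^ i) x = x}"
  have fibre: "card {i. i < N \<and> (f ^^ i) x = y} = s" if y: "y \<in> O'" for y
  proof -
    from y obtain j where j: "j < N" "y = (f ^^ j) x"
      by (auto simp: O'_def)
    \<comment> \<open>Completing the cycle leads back to \<open>x\<close>; as iterates commute, a
      return time of one orbit point is a return time of every other.\<close>
    have return: "(f ^^ (N - j)) ((f ^^ j) x) = x"
      using j(1) cycle fun_cong[OF funpow_add[of "N - j" j f], of x] by simp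
    have eq: "(f ^^ i) ((f ^^ j) x) = (f ^^ j) x \<longleftrightarrow> (f ^^ i) x = x" for i
    proof
      assume a: "(f ^^ i) ((f ^^ j) x) = (f ^^ j) x"
      have "(f ^^ i) x = (f ^^ i) ((f ^^ (N - j)) ((f ^^ j) x))"
        by (simp add: return)
      also have "\<dots> = (f ^^ (N - j)) ((f ^^ i) ((f ^^ j) x))"
        using funpow_commute[of i f "N - j" "(f ^^ j) x"] by simp
      finally show "(f ^^ i) x = x"
        by (simp add: a return)
    next
      assume "(f ^^ i) x = x"
      then show "(f ^^ i) ((f ^^ j) x) = (f ^^ j) x"
        by (rule funpow_cycle)
    qed
    show ?thesis
      using card_funpow_shifts[OF cycle, of "\<lambda>z. z = y" j] by (simp add: s_def j(2) eq)
  qed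
  have count: "card {i. i < N \<and> Q ((f ^^ i) x)} = card {y \<in> O'. Q y} * s" for Q
  proof -
    have "{i. i < N \<and> Q ((f ^^ i) x)} = (\<Union>y\<in>{y \<in> O'. Q y}. {i. i < N \<and> (f ^^ i) x = y})"
      by (auto simp: O'_def)
    also have "card \<dots> = (\<Sum>y\<in>{y \<in> O'. Q y}. card {i. i < N \<and> (f ^^ i) x = y})"
      by (rule card_UN_disjoint) (auto simp: O'_def)
    also have "\<dots> = (\<Sum>y\<in>{y \<in> O'. Q y}. s)"
      by (rule sum.cong) (auto simp: fibre)
    finally show ?thesis by simp
  qed
  have "N = card O' * s"
    using count[of "\<lambda>_. True"] by simp
  then show ?thesis
    using count[of P] by simp
qed

section \<open>Walks with steps bounded below by -1\<close>

text \<open>The walk may jump up but falls by at most one per step, so it cannot skip a level on its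
  way down.\<close>

lemma downward_intermediate_value:
  fixes h :: "nat \<Rightarrow> int"
  assumes "\<And>i. \<lbrakk>a \<le> i; i < b\<rbrakk> \<Longrightarrow> h i - 1 \<le> h (Suc i)"
    and "a \<le> b" "h b \<le> k" "k \<le> h a"
  obtains i where "a \<le> i" "i \<le> b" "h i = k"
proof -
  have "\<exists>i. a \<le> i \<and> i \<le> b \<and> h i = k"
    using assms(2,1,3)
  proof (induction b rule: dec_induct)
    case base
    then show ?case using assms(4) by auto
  next
    case (step b)
    show ?case
    proof (cases "h b \<le> k")
      case True
      then obtain i where "a \<le> i" "i \<le> b" "h i = k"
        using step.IH step.prems(1) by (metis less_SucI)
      then show ?thesis by (intro exI[of _ i]) simp
    next
      case False
      then have "h (Suc b) = k"
        using step.prems step.hyps by (smt (verit) lessI)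
      then show ?thesis
        using step.hyps by (metis le_SucI order_refl)
    qed
  qed
  then show ?thesis using that by blast
qed

text \<open>The minimum \<open>m\<close> over a sliding window of \<open>Suc M\<close> values falls
  by exactly one when the entering value is a strict record and stays put otherwise. Over a full
  period it falls by 2.\<close>

lemma two_records_per_period:
  fixes H :: "nat \<Rightarrow> int"
  assumes period: "\<And>i. H (i + Suc M) = H i - 2"
    and step: "\<And>i. H i - 1 \<le> H (Suc i)"
  shows "card {j. j < Suc M \<and> (\<forall>i<M. H (Suc j + M) < H (Suc j + i))} = 2"
proof -
  define R where "R j \<longleftrightarrow> (\<forall>i<M. H (Suc j + M) < H (Suc j + i))" for j
  define m where "m j = Min (H ` {j..j + M})" for j
  have fin: "finite (H ` {j..j + M})" "H ` {j..j + M} \<noteq> {}" for j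
    by auto
  have next_val: "H j = H (Suc j + M) + 2" for j
    using period[of j] by simp
  have m_Suc: "m (Suc j) = min (m j) (H (Suc j + M))" for j
  proof -
    \<comment> \<open>Both windows are completed to the same set. The leaving value
      \<open>H j\<close> exceeds the entering one by 2, so it does not affect the minimum.\<close>
    have "H ` insert j {Suc j..Suc j + M} = H ` insert (Suc j + M) {j..j + M}"
      by (rule arg_cong[of _ _ "(`) H"]) auto
    then have "insert (H j) (H ` {Suc j..Suc j + M}) = insert (H (Suc j + M)) (H ` {j..j + M})"
      by simp
    then have "min (H j) (m (Suc j)) = min (H (Suc j + M)) (m j)"
      unfolding m_def using fin by (metis Min_insert)
    moreover have "m (Suc j) \<le> H (Suc j + M)"
      unfolding m_def by (rule Min_le) auto
    ultimately show ?thesis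
      using next_val[of j] by linarith
  qed
  \<comment> \<open>\<open>R j\<close> leaves out index \<open>j\<close>, where the inequality is
    automatic by periodicity.\<close>
  have R_iff: "R j \<longleftrightarrow> H (Suc j + M) < m j" for j
  proof -
    have "H (Suc j + M) < m j \<longleftrightarrow> (\<forall>i\<in>{j..j + M}. H (Suc j + M) < H i)"
      unfolding m_def using fin by simp
    also have "{j..j + M} = insert j ((\<lambda>i. Suc j + i) ` {..<M})"
    proof -
      have "(\<lambda>i. Suc j + i) ` {..<M} = {Suc j..<Suc j + M}"
        unfolding lessThan_atLeast0 image_add_atLeastLessThan by (simp add: add.commute)
      then show ?thesis by auto
    qed
    also have "(\<forall>i\<in>\<dots>. H (Suc j + M) < H i) \<longleftrightarrow> R j"
      using next_val[of j] by (auto simp: R_def)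
    finally show ?thesis by simp
  qed
  have drop: "of_bool (R j) = m j - m (Suc j)" for j
  proof -
    have "m j \<le> H (j + M)"
      unfolding m_def by (rule Min_le) auto
    then have "m j - 1 \<le> H (Suc j + M)"
      using step[of "j + M"] by simp
    then show ?thesis
      unfolding R_iff m_Suc by auto
  qed
  have "m (Suc M) = m 0 - 2"
  proof -
    have "H ` {Suc M..Suc M + M} = (\<lambda>v. v - 2) ` H ` {0..0 + M}"
    proof -
      have "{Suc M..Suc M + M} = (\<lambda>i. i + Suc M) ` {0..0 + M}"
        by (simp del: add_Suc_right)
      then show ?thesis
        by (simp only: image_image period)
    qed
    then have "m (Suc M) = Min ((\<lambda>v. v - 2) ` H ` {0..0 + M})"
      by (simp add: m_def)
    also have "\<dots> = Min (H ` {0..0 + M}) - 2"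
      by (rule mono_Min_commute[symmetric]) (auto simp: mono_def)
    finally show ?thesis by (simp add: m_def)
  qed
  moreover have "int (card {j. j < Suc M \<and> R j}) = (\<Sum>j<Suc M. of_bool (R j))"
    unfolding card_eq_sum_of_bool of_nat_sum by (simp only: of_nat_of_bool)
  moreover have "\<dots> = m 0 - m (Suc M)"
    unfolding drop by (rule sum_lessThan_telescope')
  ultimately show ?thesis
    by (simp add: R_def)
qed

text \<open>Here \<open>h\<close> lists the heights of a balanced tree with its root leaf at
  \<open>M\<close>. After rerooting at leaf \<open>p\<close>, the leaves before it come one round
  later, hence 2 lower, and the old root \<open>M\<close> replaces \<open>p\<close> among the
  ordinary leaves. The new minimum \<open>m\<close> is -1 or 0.\<close>

lemma rerooted_distribution_bounds:
  fixes h :: "nat \<Rightarrow> int" and k :: int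
  assumes pos: "\<And>i. i < M \<Longrightarrow> 1 \<le> h i" and last: "h M = 0"
    and step: "\<And>i. i < M \<Longrightarrow> h i - 1 \<le> h (Suc i)"
    and p: "p < M" and k: "1 \<le> k"
  defines "g \<equiv> \<lambda>i. if i \<le> p then h i - 2 else h i"
  defines "I \<equiv> {..M} - {p}"
  defines "m \<equiv> Min (g ` I)"
  shows "card {i \<in> I. g i < m + (k - 2)} \<le> card {i. i < M \<and> h i \<le> k}"
    and "card {i. i < M \<and> h i \<le> k} \<le> card {i \<in> I. g i < m + (k + 2)}"
proof -
  have M: "M \<in> I" "g M = 0"
    using p last by (auto simp: I_def g_def)
  have "m \<le> 0"
    unfolding m_def using M by (metis Min_le I_def finite_Diff finite_atMost finite_imageI imageI)
  have "-1 \<le> g i" if "i \<in> I" for i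
    using that pos[of i] last p by (cases "i = M") (auto simp: I_def g_def)
  then have "-1 \<le> m"
    unfolding m_def using M by (subst Min_ge_iff) (auto simp: I_def)
  define B where "B = {i. i < M \<and> h i \<le> k}"
  have finB: "finite B" by (simp add: B_def)
  have finA: "finite {i \<in> I. Q i}" for Q by (simp add: I_def)
  show "card {i \<in> I. g i < m + (k - 2)} \<le> card {i. i < M \<and> h i \<le> k}"
  proof -
    let ?A = "{i \<in> I. g i < m + (k - 2)}"
    \<comment> \<open>\<open>M\<close> may be an extra element of \<open>?A\<close>, so an element
      of \<open>B\<close> outside \<open>?A\<close> must make up for it: \<open>p\<close> if it lies
      in \<open>B\<close>, else a later point where the walk, descending to 0, meets level
      \<open>k\<close>.\<close>
    obtain q where q: "q \<in> B" "q \<notin> ?A"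
    proof (cases "p \<in> B")
      case True
      then show ?thesis using that by (auto simp: I_def)
    next
      case False
      then have "k \<le> h p" using p by (auto simp: B_def)
      then obtain i where i: "p \<le> i" "i \<le> M" "h i = k"
        using p k last step by (elim downward_intermediate_value[of p M h k, rotated 3]) auto
      then have "i \<noteq> M" using k last by auto
      then have "i \<in> B" "i \<notin> ?A"
        using i \<open>m \<le> 0\<close> by (auto simp: B_def g_def split: if_splits)
      then show ?thesis using that by blast
    qed
    have "?A - {M} \<subseteq> B - {q}"
      using q \<open>m \<le> 0\<close> by (auto simp: B_def I_def g_def split: if_splits)
    then have "card (?A - {M}) \<le> card (B - {q})"
      using finB by (simp add: card_mono)
    moreover have "card B = Suc (card (B - {q}))"
      using q finB by (meson card.remove)
    moreover have "card ?A \<le> Suc (card (?A - {M}))"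
      by (simp add: card_Diff_singleton_if) arith
    ultimately show ?thesis by (simp add: B_def)
  qed
  show "card {i. i < M \<and> h i \<le> k} \<le> card {i \<in> I. g i < m + (k + 2)}"
  proof -
    let ?A = "{i \<in> I. g i < m + (k + 2)}"
    \<comment> \<open>Here \<open>p\<close> may be lost, and \<open>M\<close> makes up for
      it.\<close>
    have "B - {p} \<subseteq> ?A - {M}"
      using \<open>-1 \<le> m\<close> by (auto simp: B_def I_def g_def)
    then have "card (B - {p}) \<le> card (?A - {M})"
      using finA by (simp add: card_mono)
    moreover have "M \<in> ?A"
      using M \<open>-1 \<le> m\<close> k by auto
    then have "card ?A = Suc (card (?A - {M}))"
      by (rule card.remove[OF finA])
    moreover have "card B \<le> Suc (card (B - {p}))"
      by (simp add: card_Diff_singleton_if) arith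
    ultimately show ?thesis by (simp add: B_def)
  qed
qed

section \<open>Blossom trees\<close>

text \<open>The bud of an inner node sits before, between or after its two subtrees.\<close>

datatype bud = First | Second | Third

datatype blossom = Leaf | Branch bud blossom blossom

fun nodes :: "blossom \<Rightarrow> nat" where
  "nodes Leaf = 0"
| "nodes (Branch b l r) = Suc (nodes l + nodes r)"

text \<open>Heights just before the leaves other than the root, for a walk that starts at height \<open>k\<close>;
  it ends at height \<open>k - 1\<close>.\<close>

fun heights :: "int \<Rightarrow> blossom \<Rightarrow> int list" where
  "heights k Leaf = [k]"
| "heights k (Branch b l r) =
     heights (k + of_bool (b = First)) l @ heights (k - of_bool (b = Third)) r"

lemma length_heights: "length (heights k t) = Suc (nodes t)"
  by (induction t arbitrary: k) auto

lemma heights_nonempty [simp]: "heights k t \<noteq> []"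
  using length_heights[of k t] by auto

lemma heights_shift: "heights (k + c) t = map (\<lambda>x. x + c) (heights k t)"
proof (induction t arbitrary: k)
  case (Branch b l r)
  have "k + c + of_bool (b = First) = k + of_bool (b = First) + c"
    "k + c - of_bool (b = Third) = k - of_bool (b = Third) + c"
    by auto
  then show ?case
    by (simp only: heights.simps Branch map_append)
qed simp

lemma heights_hd: "k \<le> hd (heights k t)"
proof (induction t arbitrary: k)
  case (Branch b l r)
  then show ?case
    using order_trans[OF _ Branch(1)[of "k + of_bool (b = First)"], of k] by simp
qed simp

lemma heights_last: "last (heights k t) \<le> k"
proof (induction t arbitrary: k)
  case (Branch b l r)
  then show ?case
    using order_trans[OF Branch(2)[of "k - of_bool (b = Third)"], of k] by simp
qed simp

text \<open>Only the junction of the two subtrees matters. A bud occupies a single corner, so the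
  corrections for \<open>First\<close> and \<open>Third\<close> never add up to a drop by 2.\<close>

lemma heights_successively: "successively (\<lambda>x y. x - 1 \<le> y) (heights k t)"
proof (induction t arbitrary: k)
  case (Branch b l r)
  have "last (heights (k + of_bool (b = First)) l) \<le> k + of_bool (b = First)"
    by (rule heights_last)
  moreover have "k - of_bool (b = Third) \<le> hd (heights (k - of_bool (b = Third)) r)"
    by (rule heights_hd)
  ultimately show ?case
    using Branch by (cases b) (auto simp: successively_append_iff)
qed simp

text \<open>The contour word: \<open>None\<close> is a leaf, \<open>Some c\<close> a corner at an inner node, where \<open>c\<close> tells
  whether the corner contains the bud.\<close>

fun contour :: "blossom \<Rightarrow> bool option list" where
  "contour Leaf = [None]"
| "contour (Branch b l r) =
     Some (b = First) # contour l @ Some (b = Second) # contour r @ [Some (b = Third)]"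

text \<open>The contour can be parsed uniquely from left to right, and the corner marks determine
  the bud. The tails \<open>u\<close> and \<open>v\<close> make the induction work.\<close>

lemma contour_prefix_free:
  "contour s @ u = contour t @ v \<Longrightarrow> s = t \<and> u = v"
proof (induction s arbitrary: t u v)
  case Leaf
  then show ?case by (cases t) auto
next
  case (Branch b l r)
  from Branch.prems obtain b' l' r' where t: "t = Branch b' l' r'"
    by (cases t) auto
  from Branch.prems have *: "(b = First) = (b' = First)"
    "contour l @ Some (b = Second) # contour r @ Some (b = Third) # u =
      contour l' @ Some (b' = Second) # contour r' @ Some (b' = Third) # v"
    by (auto simp: t)
  from Branch.IH(1)[OF *(2)] have l: "l = l'" and "(b = Second) = (b' = Second)"
    and **: "contour r @ Some (b = Third) # u = contour r' @ Some (b' = Third) # v"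
    by auto
  moreover from Branch.IH(2)[OF **] have "r = r'" "u = v"
    by auto
  ultimately show ?case
    using *(1) by (cases b; cases b') (auto simp: t)
qed

lemma count_contour: "count_list (contour t) None = Suc (nodes t)"
  by (induction t) auto

text \<open>\<open>reroot_at_first t s\<close> glues \<open>t\<close> and \<open>s\<close> along their root edges and takes the first leaf
  of \<open>t\<close> as the new root; \<open>turn\<close> is the bud position seen from the left child instead of the
  parent.\<close>

fun turn :: "bud \<Rightarrow> bud" where
  "turn First = Third"
| "turn Second = First"
| "turn Third = Second"

fun reroot_at_first :: "blossom \<Rightarrow> blossom \<Rightarrow> blossom" where
  "reroot_at_first Leaf s = s"
| "reroot_at_first (Branch b l r) s = reroot_at_first l (Branch (turn b) r s)"

text \<open>Gluing \<open>Leaf\<close> to the root edge turns the old root into an ordinary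
  leaf.\<close>

definition reroot :: "blossom \<Rightarrow> blossom" where
  "reroot t = reroot_at_first t Leaf"

section \<open>Rerooting as rotation of the contour word\<close>

lemma nodes_reroot_at_first: "nodes (reroot_at_first t s) = nodes t + nodes s"
  by (induction t s rule: reroot_at_first.induct) auto

lemma nodes_reroot: "nodes (reroot t) = nodes t"
  by (simp add: reroot_def nodes_reroot_at_first)

lemma nodes_funpow_reroot: "nodes ((reroot ^^ i) t) = nodes t"
  by (induction i) (simp_all add: nodes_reroot)

text \<open>The word \<open>u\<close> consists of the corners met before the first leaf. The new
  contour starts behind that leaf, passes through \<open>s\<close> where the old root was, and ends
  with \<open>u\<close>; \<open>turn\<close> keeps the bud in its corner.\<close>

lemma contour_reroot_at_first:
  "\<exists>u v. None \<notin> set u \<and> contour t = u @ None # v \<and>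
     contour (reroot_at_first t s) = v @ contour s @ u"
proof (induction t s rule: reroot_at_first.induct)
  case (1 s)
  show ?case by (intro exI[of _ "[]"]) simp
next
  case (2 b l r s)
  then obtain u v where uv: "None \<notin> set u" "contour l = u @ None # v"
    "contour (reroot_at_first l (Branch (turn b) r s)) = v @ contour (Branch (turn b) r s) @ u"
    by blast
  show ?case
  proof (intro exI conjI)
    show "None \<notin> set (Some (b = First) # u)"
      using uv(1) by simp
    show "contour (Branch b l r) = (Some (b = First) # u) @ None #
        (v @ Some (b = Second) # contour r @ [Some (b = Third)])"
      using uv(2) by simp
    show "contour (reroot_at_first (Branch b l r) s) =
        (v @ Some (b = Second) # contour r @ [Some (b = Third)]) @ contour s @
        (Some (b = First) # u)"
      using uv(3) by (cases b) auto
  qed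
qed

text \<open>On a contour closed by a \<open>None\<close> for the root leaf, this is one
  rerooting.\<close>

definition rotate_block :: "'a option list \<Rightarrow> 'a option list" where
  "rotate_block w = tl (dropWhile (\<lambda>x. x \<noteq> None) w) @ takeWhile (\<lambda>x. x \<noteq> None) w @ [None]"

lemma rotate_block_append: "None \<notin> set u \<Longrightarrow> rotate_block (u @ None # v) = v @ u @ [None]"
proof -
  assume "None \<notin> set u"
  then have "\<forall>x\<in>set u. x \<noteq> None" by metis
  then show ?thesis
    by (simp add: rotate_block_def takeWhile_append dropWhile_append)
qed

text \<open>The hypothesis says that \<open>p\<close> is made of complete blocks, each ending in
  \<open>None\<close>; every application moves one of them.\<close>

lemma funpow_rotate_block:
  assumes "p = [] \<or> last p = None"
  shows "(rotate_block ^^ count_list p None) (p @ q) = q @ p"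
  using assms
proof (induction "count_list p None" arbitrary: p q)
  case 0
  then have "p = []"
    by (metis count_list_0_iff last_in_set)
  then show ?case by simp
next
  case (Suc c)
  then have "None \<in> set p"
    by (metis count_list_0_iff nat.distinct(1))
  then obtain u p' where p: "p = u @ None # p'" and u: "None \<notin> set u"
    by (meson split_list_first)
  have c: "c = count_list p' None"
    using Suc(2) u by (simp add: p count_list_0_iff[THEN iffD2])
  have "p' = [] \<or> last p' = None"
    using Suc.prems by (auto simp: p split: if_splits)
  then have "(rotate_block ^^ c) (p' @ q @ u @ [None]) = q @ u @ None # p'"
    using Suc(1)[OF c, of "q @ u @ [None]"] c by simp
  then show ?case
    using rotate_block_append[OF u, of "p' @ q"]
    by (simp add: p u c funpow_swap1)
qed

lemma contour_funpow_reroot: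
  "contour ((reroot ^^ i) t) @ [None] = (rotate_block ^^ i) (contour t @ [None])"
proof (induction i)
  case (Suc i)
  let ?t = "(reroot ^^ i) t"
  obtain u v where "None \<notin> set u" "contour ?t = u @ None # v"
    "contour (reroot ?t) = v @ [None] @ u"
    using contour_reroot_at_first[of ?t Leaf] by (auto simp: reroot_def)
  then have "contour (reroot ?t) @ [None] = rotate_block (contour ?t @ [None])"
    using rotate_block_append[of u "v @ [None]"] by simp
  then show ?case
    using Suc by simp
qed simp

text \<open>The closed contour has one block per leaf, root included, so this many rotations restore
  the word, and the word determines the tree.\<close>

lemma reroot_cycle: "(reroot ^^ (nodes t + 2)) t = t"
proof -
  have "count_list (contour t @ [None]) None = nodes t + 2"
    by (simp add: count_contour)
  then have "contour ((reroot ^^ (nodes t + 2)) t) @ [None] = contour t @ [None]"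
    using contour_funpow_reroot[of "nodes t + 2" t]
      funpow_rotate_block[of "contour t @ [None]" "[]"] by simp
  then show ?thesis
    using contour_prefix_free by blast
qed

text \<open>The walk around the glued tree just continues: it leaves the first leaf at
  \<open>a - 1\<close>, finishes \<open>t\<close> at \<open>k - 1\<close> and enters
  \<open>s\<close> there.\<close>

lemma heights_reroot_at_first:
  "heights k t = a # v \<Longrightarrow> heights (a - 1) (reroot_at_first t s) = v @ heights (k - 1) s"
proof (induction t s arbitrary: k v rule: reroot_at_first.induct)
  case (2 b l r s)
  obtain v' where v': "heights (k + of_bool (b = First)) l = a # v'"
    "v = v' @ heights (k - of_bool (b = Third)) r"
    using 2(2) by (cases "heights (k + of_bool (b = First)) l") auto
  show ?case
    using 2(1)[OF v'(1)] v'(2) by (cases b) auto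
qed simp

text \<open>The last entry is the height at the root leaf.\<close>

definition cyclic_heights :: "blossom \<Rightarrow> int list" where
  "cyclic_heights t = heights 1 t @ [0]"

lemma length_cyclic_heights: "length (cyclic_heights t) = nodes t + 2"
  by (simp add: cyclic_heights_def length_heights)

text \<open>The walk leaves the first leaf one below the head of the list; the shift makes it start
  at 1 again.\<close>

lemma cyclic_heights_reroot:
  "cyclic_heights (reroot t) =
     map (\<lambda>x. x + (2 - hd (cyclic_heights t))) (tl (cyclic_heights t)) @ [0]"
proof -
  obtain a v where av: "heights 1 t = a # v"
    by (meson heights_nonempty neq_Nil_conv)
  have "heights 1 (reroot t) = map (\<lambda>x. x + (2 - a)) (heights (a - 1) (reroot t))"
    using heights_shift[of "a - 1" "2 - a" "reroot t"] by simp
  also have "heights (a - 1) (reroot t) = v @ [0]"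
    unfolding reroot_def using heights_reroot_at_first[OF av, of Leaf] by simp
  finally show ?thesis
    by (simp add: cyclic_heights_def av)
qed

lemma cyclic_heights_step:
  assumes "i \<le> nodes t"
  shows "cyclic_heights t ! i - 1 \<le> cyclic_heights t ! Suc i"
proof -
  have "successively (\<lambda>x y. x - 1 \<le> y) (cyclic_heights t)"
    using heights_successively[of 1 t] heights_last[of 1 t]
    by (simp add: cyclic_heights_def successively_append_iff)
  then show ?thesis
    using assms by (simp add: successively_conv_nth length_cyclic_heights)
qed

text \<open>The walk continued round after round; each round has two more leaves than buds.\<close>

definition periodic_heights :: "blossom \<Rightarrow> nat \<Rightarrow> int" where
  "periodic_heights t i =
     cyclic_heights t ! (i mod (nodes t + 2)) - 2 * int (i div (nodes t + 2))"

lemma periodic_heights_period: "periodic_heights t (i + (nodes t + 2)) = periodic_heights t i - 2"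
proof -
  have "(i + (nodes t + 2)) div (nodes t + 2) = i div (nodes t + 2) + 1"
    by (rule div_add_self2) simp
  then show ?thesis
    unfolding periodic_heights_def mod_add_self2 by simp
qed

lemma cyclic_heights_last: "cyclic_heights t ! Suc (nodes t) = 0"
  by (simp add: cyclic_heights_def nth_append length_heights)

lemma periodic_heights_nth:
  "i < nodes t + 2 \<Longrightarrow> periodic_heights t i = cyclic_heights t ! i"
  by (simp add: periodic_heights_def)

lemma periodic_heights_step: "periodic_heights t i - 1 \<le> periodic_heights t (Suc i)"
proof (cases "Suc (i mod (nodes t + 2)) = nodes t + 2")
  case True
  \<comment> \<open>At the seam between rounds the root has height 0 and the next leaf at least 1 -
    2.\<close>
  have "1 \<le> cyclic_heights t ! 0"
    using heights_hd[of 1 t] by (simp add: cyclic_heights_def nth_append length_heights hd_conv_nth)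
  moreover have "i mod (nodes t + 2) = Suc (nodes t)"
    using True by simp
  ultimately show ?thesis
    using True cyclic_heights_last[of t]
    by (simp add: periodic_heights_def mod_Suc div_Suc)
next
  case False
  moreover have "i mod (nodes t + 2) < nodes t + 2"
    by simp
  ultimately have "i mod (nodes t + 2) \<le> nodes t"
    by linarith
  from cyclic_heights_step[OF this] show ?thesis
    using False by (simp add: periodic_heights_def mod_Suc div_Suc)
qed

text \<open>Rerooting moves the window on the periodic walk; subtracting the height at the new root
  leaf normalises that height to 0.\<close>

lemma cyclic_heights_funpow_reroot:
  assumes "i < nodes t + 2"
  shows "cyclic_heights ((reroot ^^ j) t) ! i =
    periodic_heights t (j + i) - periodic_heights t (j + Suc (nodes t))"
  using assms
proof (induction j arbitrary: i)
  case 0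
  then show ?case
    by (simp add: periodic_heights_nth cyclic_heights_last)
next
  case (Suc j)
  let ?t = "(reroot ^^ j) t"
  have len: "length (cyclic_heights ?t) = nodes t + 2"
    by (simp add: length_cyclic_heights nodes_funpow_reroot)
  have hd: "hd (cyclic_heights ?t) = cyclic_heights ?t ! 0"
    using len by (intro hd_conv_nth) auto
  show ?case
  proof (cases "i = Suc (nodes t)")
    case True
    then show ?thesis
      by (simp add: cyclic_heights_reroot nth_append len)
  next
    case False
    with Suc.prems have i: "Suc i < nodes t + 2"
      by simp
    then have "cyclic_heights ((reroot ^^ Suc j) t) ! i =
        cyclic_heights ?t ! Suc i + (2 - cyclic_heights ?t ! 0)"
      by (simp add: cyclic_heights_reroot nth_append len nth_tl hd)
    also have "\<dots> = periodic_heights t (j + Suc i) + 2 - periodic_heights t j"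
      using Suc.IH[OF i] Suc.IH[of 0] by simp
    also have "\<dots> = periodic_heights t (Suc j + i) - periodic_heights t (Suc j + Suc (nodes t))"
      using periodic_heights_period[of t j] by simp
    finally show ?thesis .
  qed
qed

lemma heights_nth: "i \<le> nodes t \<Longrightarrow> heights 1 t ! i = cyclic_heights t ! i"
  by (simp add: cyclic_heights_def nth_append length_heights)

section \<open>Balanced blossom trees among the rerootings\<close>

definition balanced :: "blossom \<Rightarrow> bool" where
  "balanced t \<longleftrightarrow> (\<forall>x\<in>set (heights 1 t). 0 < x)"

lemma balanced_nth: "balanced t \<longleftrightarrow> (\<forall>i<Suc (nodes t). 0 < cyclic_heights t ! i)"
  by (auto simp: balanced_def all_set_conv_all_nth length_heights heights_nth less_Suc_eq_le)

text \<open>A rerooting is balanced exactly when its root leaf is a strict record of the periodic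
  walk.\<close>

lemma card_balanced_reroots:
  "card {j. j < nodes t + 2 \<and> balanced ((reroot ^^ j) t)} = 2"
proof -
  have "balanced ((reroot ^^ Suc j) t) \<longleftrightarrow>
      (\<forall>i<Suc (nodes t). periodic_heights t (Suc j + Suc (nodes t)) < periodic_heights t (Suc j + i))"
    for j
    unfolding balanced_nth nodes_funpow_reroot
    by (simp add: cyclic_heights_funpow_reroot del: funpow.simps)
  moreover have "card {j. j < Suc (Suc (nodes t)) \<and>
      (\<forall>i<Suc (nodes t). periodic_heights t (Suc j + Suc (nodes t)) < periodic_heights t (Suc j + i))} = 2"
    using periodic_heights_period[of t] periodic_heights_step[of t]
    by (intro two_records_per_period) auto
  ultimately have "card {j. j < nodes t + 2 \<and> balanced ((reroot ^^ Suc j) t)} = 2"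
    by simp
  \<comment> \<open>The records were counted from index \<open>Suc j\<close>; on a cycle this shift
    does not change their number.\<close>
  then show ?thesis
    using card_funpow_shift[OF reroot_cycle, of t balanced] by (simp add: funpow_swap1)
qed

section \<open>Embedded trees as blossom trees\<close>

fun graft :: "ltree \<Rightarrow> ltree \<Rightarrow> ltree" where
  "graft t (Node a ts) = Node a (t # ts)"

text \<open>The bud encodes the label of the first child relative to its parent. For
  \<open>Third\<close> the subtrees swap roles because the right one is walked from height
  \<open>k - 1\<close>, the left one from \<open>k\<close>.\<close>

fun to_ltree :: "int \<Rightarrow> blossom \<Rightarrow> ltree" where
  "to_ltree k Leaf = Node k []"
| "to_ltree k (Branch First l r) = graft (to_ltree (k + 1) l) (to_ltree k r)"
| "to_ltree k (Branch Second l r) = graft (to_ltree k l) (to_ltree k r)"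
| "to_ltree k (Branch Third l r) = graft (to_ltree (k - 1) r) (to_ltree k l)"

lemma graft_props [simp]:
  "root_label (graft s t) = root_label t"
  "num_edges (graft s t) = Suc (num_edges s + num_edges t)"
  "adjacent_labels_close (graft s t) \<longleftrightarrow>
     \<bar>root_label s - root_label t\<bar> \<le> 1 \<and> adjacent_labels_close s \<and> adjacent_labels_close t"
  "mset (labels (graft s t)) = mset (labels s) + mset (labels t)"
  "graft s t = graft s' t' \<longleftrightarrow> s = s' \<and> t = t'"
  "graft s t \<noteq> Node k []"
  by (cases t; cases t'; auto)+

lemma root_label_to_ltree [simp]: "root_label (to_ltree k t) = k"
  by (induction k t rule: to_ltree.induct) auto

lemma num_edges_to_ltree: "num_edges (to_ltree k t) = nodes t"
  by (induction k t rule: to_ltree.induct) auto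

lemma adjacent_labels_close_to_ltree: "adjacent_labels_close (to_ltree k t)"
  by (induction k t rule: to_ltree.induct) auto

text \<open>The orders of the two lists may differ, but label distributions depend only on the
  multiset.\<close>

lemma mset_labels_to_ltree: "mset (labels (to_ltree k t)) = mset (heights k t)"
  by (induction k t rule: to_ltree.induct) auto

text \<open>The root label of the first child reveals the bud, and \<open>graft\<close> is
  injective.\<close>

lemma to_ltree_inject: "to_ltree k s = to_ltree k t \<Longrightarrow> s = t"
proof (induction k s arbitrary: t rule: to_ltree.induct)
  case (1 k)
  then show ?case
    by (cases "(k, t)" rule: to_ltree.cases) (auto dest: sym)
next
  case (2 k l r)
  then show ?case
    by (cases "(k, t)" rule: to_ltree.cases) (auto dest: arg_cong[of _ _ root_label])
next
  case (3 k l r)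
  then show ?case
    by (cases "(k, t)" rule: to_ltree.cases) (auto dest: arg_cong[of _ _ root_label])
next
  case (4 k l r)
  then show ?case
    by (cases "(k, t)" rule: to_ltree.cases) (auto dest: arg_cong[of _ _ root_label])
qed

text \<open>Cutting off the first subtree leaves two smaller trees; the difference of their root
  labels selects the bud.\<close>

lemma to_ltree_surj:
  "adjacent_labels_close T \<Longrightarrow> \<exists>t. T = to_ltree (root_label T) t"
proof (induction T rule: measure_induct_rule[of size])
  case (less T)
  show ?case
  proof (cases T)
    case (Node a ts)
    show ?thesis
    proof (cases ts)
      case Nil
      then show ?thesis
        using Node by (metis ltree.sel(1) to_ltree.simps(1))
    next
      case (Cons s ss)
      have T: "T = graft s (Node a ss)"
        by (simp add: Node Cons)
      with less.prems have close: "\<bar>root_label s - a\<bar> \<le> 1" "adjacent_labels_close s"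
        "adjacent_labels_close (Node a ss)"
        by auto
      obtain l r where lr: "s = to_ltree (root_label s) l" "Node a ss = to_ltree a r"
        using less.IH[of s] less.IH[of "Node a ss"] close by (auto simp: Node Cons)
      consider "root_label s = a + 1" | "root_label s = a" | "root_label s = a - 1"
        using close(1) by linarith
      then have "\<exists>t. T = to_ltree a t"
        by cases (metis T lr to_ltree.simps(2-4))+
      then show ?thesis
        by (simp add: Node)
    qed
  qed
qed

lemma bij_betw_to_ltree: "bij_betw (to_ltree 1) {t. nodes t = n} (embedded_trees n)"
  unfolding bij_betw_def
proof
  show "inj_on (to_ltree 1) {t. nodes t = n}"
    by (auto intro: inj_onI dest: to_ltree_inject)
  show "to_ltree 1 ` {t. nodes t = n} = embedded_trees n"
  proof (intro equalityI subsetI)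
    fix T assume T: "T \<in> embedded_trees n"
    then obtain t where "T = to_ltree 1 t"
      using to_ltree_surj[of T] by (auto simp: embedded_trees_def)
    then show "T \<in> to_ltree 1 ` {t. nodes t = n}"
      using T by (auto simp: embedded_trees_def num_edges_to_ltree)
  qed (auto simp: embedded_trees_def num_edges_to_ltree adjacent_labels_close_to_ltree)
qed

lemma well_labelled_to_ltree:
  "to_ltree 1 t \<in> well_labelled_trees n \<longleftrightarrow> nodes t = n \<and> balanced t"
proof -
  have "set (labels (to_ltree 1 t)) = set (heights 1 t)"
    using mset_labels_to_ltree by (metis set_mset_mset)
  then show ?thesis
    by (auto simp: well_labelled_trees_def embedded_trees_def num_edges_to_ltree
        adjacent_labels_close_to_ltree balanced_def)
qed

section \<open>Label distributions\<close>

lemma sum_count_list: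
  fixes A :: "'a set"
  assumes "finite A"
  shows "(\<Sum>l\<in>A. count_list xs l) = card {i. i < length xs \<and> xs ! i \<in> A}"
proof -
  have "(\<Sum>l\<in>A. count_list xs l) = length (filter (\<lambda>x. x \<in> A) xs)"
  proof (induction xs)
    case (Cons x xs)
    have "(\<Sum>l\<in>A. count_list (x # xs) l) = (\<Sum>l\<in>A. (if x = l then 1 else 0) + count_list xs l)"
      by (intro sum.cong) auto
    also have "\<dots> = of_bool (x \<in> A) + (\<Sum>l\<in>A. count_list xs l)"
      using assms by (simp add: sum.distrib)
    finally show ?case
      using Cons by simp
  qed simp
  then show ?thesis
    by (simp add: length_filter_conv_card)
qed

lemma label_count_to_ltree: "label_count (to_ltree k t) x = count_list (heights k t) x"
  unfolding label_count_def by (metis count_mset mset_labels_to_ltree)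

text \<open>Balance makes the lower end of the range 1 to \<open>k\<close> automatic.\<close>

lemma cum_labels_to_ltree:
  assumes "balanced t"
  shows "cum_labels (to_ltree 1 t) k = card {i. i < Suc (nodes t) \<and> cyclic_heights t ! i \<le> k}"
proof -
  have "{i. i < length (heights 1 t) \<and> heights 1 t ! i \<in> {1..k}} =
      {i. i < Suc (nodes t) \<and> cyclic_heights t ! i \<le> k}"
    using assms by (auto simp: balanced_nth length_heights heights_nth less_Suc_eq_le)
  then show ?thesis
    unfolding cum_labels_def label_count_to_ltree by (simp add: sum_count_list)
qed

lemma cum_labels_rel_to_ltree:
  defines "m \<equiv> \<lambda>t. Min ((!) (cyclic_heights t) ` {..<Suc (nodes t)})"
  shows "cum_labels_rel (to_ltree 1 t) k =
    card {i. i < Suc (nodes t) \<and> cyclic_heights t ! i < m t + k}"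
proof -
  have "set (labels (to_ltree 1 t)) = set (heights 1 t)"
    using mset_labels_to_ltree by (metis set_mset_mset)
  also have "\<dots> = (!) (heights 1 t) ` {..<Suc (nodes t)}"
    by (auto simp: set_conv_nth length_heights)
  also have "\<dots> = (!) (cyclic_heights t) ` {..<Suc (nodes t)}"
    by (intro image_cong) (auto simp: heights_nth)
  finally have min: "min_label (to_ltree 1 t) = m t"
    by (simp add: min_label_def m_def)
  have "cum_labels_rel (to_ltree 1 t) k = (\<Sum>l=1..k. count_list (heights 1 t) (m t + l - 1))"
    by (simp add: cum_labels_rel_def label_count_to_ltree min)
  also have "\<dots> = (\<Sum>l=m t..m t + k - 1. count_list (heights 1 t) l)"
    by (rule sum.reindex_bij_witness[of _ "\<lambda>l. l - m t + 1" "\<lambda>l. m t + l - 1"]) auto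
  also have "\<dots> = card {i. i < length (heights 1 t) \<and> heights 1 t ! i \<in> {m t..m t + k - 1}}"
    by (rule sum_count_list) simp
  also have "{i. i < length (heights 1 t) \<and> heights 1 t ! i \<in> {m t..m t + k - 1}} =
      {i. i < Suc (nodes t) \<and> cyclic_heights t ! i < m t + k}"
  proof -
    have "m t \<le> cyclic_heights t ! i" if "i < Suc (nodes t)" for i
      unfolding m_def using that by (intro Min_le) auto
    then show ?thesis
      by (auto simp: length_heights heights_nth less_Suc_eq_le)
  qed
  finally show ?thesis .
qed

lemma conjugate_distribution_bounds:
  assumes bal: "balanced t" and j: "j < nodes t + 2" and k: "1 \<le> k"
  defines "U \<equiv> to_ltree 1 ((reroot ^^ j) t)"
  shows "cum_labels_rel U (k - 2) \<le> cum_labels (to_ltree 1 t) k"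
    and "cum_labels (to_ltree 1 t) k \<le> cum_labels_rel U (k + 2)"
proof -
  define h where "h i = cyclic_heights t ! i" for i
  define M where "M = Suc (nodes t)"
  have W: "cum_labels (to_ltree 1 t) k = card {i. i < M \<and> h i \<le> k}"
    by (simp add: cum_labels_to_ltree[OF bal] M_def h_def)
  have pos: "1 \<le> h i" if "i < M" for i
    using bal that by (auto simp: balanced_nth M_def h_def int_one_le_iff_zero_less)
  have last: "h M = 0"
    by (simp add: M_def h_def cyclic_heights_last)
  have step: "h i - 1 \<le> h (Suc i)" if "i < M" for i
    using that cyclic_heights_step[of i t] by (simp add: M_def h_def)
  show "cum_labels_rel U (k - 2) \<le> cum_labels (to_ltree 1 t) k"
    and "cum_labels (to_ltree 1 t) k \<le> cum_labels_rel U (k + 2)"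
  proof (atomize (full), cases j)
    case 0
    then have U: "U = to_ltree 1 t" by (simp add: U_def)
    define m where "m = Min (h ` {..<M})"
    have rel: "cum_labels_rel U k' = card {i. i < M \<and> h i < m + k'}" for k'
      by (simp add: U cum_labels_rel_to_ltree m_def M_def h_def)
    have "1 \<le> m"
      unfolding m_def using pos by (subst Min_ge_iff) (auto simp: M_def lessThan_empty_iff)
    have "m \<le> 1"
    proof -
      \<comment> \<open>The last leaf before the root is at most one above the root height 0, so the
        label 1 is attained.\<close>
      have "h (nodes t) \<le> 1"
        using step[of "nodes t"] last by (simp add: M_def)
      moreover have "m \<le> h (nodes t)"
        unfolding m_def by (rule Min_le) (auto simp: M_def)
      ultimately show ?thesis by linarith
    qed
    show "cum_labels_rel U (k - 2) \<le> cum_labels (to_ltree 1 t) k \<and>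
        cum_labels (to_ltree 1 t) k \<le> cum_labels_rel U (k + 2)"
      unfolding W rel using \<open>m \<le> 1\<close> \<open>1 \<le> m\<close> by (auto intro!: card_mono)
  next
    case (Suc p)
    then have p: "p < M" using j by (simp add: M_def)
    define g where "g = (\<lambda>i. if i \<le> p then h i - 2 else h i)"
    define I where "I = {..M} - {p}"
    define H where "H = periodic_heights t"
    \<comment> \<open>The height at the new root leaf, a common shift that cancels because the
      distribution is relative to the minimum.\<close>
    define c where "c = H (j + M)"
    \<comment> \<open>the positions in the walk, starting after leaf \<open>p\<close>, of the leaves other than \<open>p\<close>\<close>
    define place where "place i = (if i \<le> p then i + Suc M else i)" for i
    have place_I: "bij_betw place I {j..<j + M}"
    proof (rule bij_betwI[of _ _ _ "\<lambda>r. if r < Suc M then r else r - Suc M"])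
    qed (use p Suc in \<open>auto simp: place_def I_def split: if_splits\<close>)
    have H_place: "H (place i) = g i" if "i \<in> I" for i
    proof -
      have "H i = h i"
        using that by (simp add: H_def h_def I_def M_def periodic_heights_nth)
      then show ?thesis
        using periodic_heights_period[of t i] by (simp add: place_def g_def H_def M_def)
    qed
    have U_nth: "cyclic_heights ((reroot ^^ j) t) ! i = H (j + i) - c" if "i < M" for i
      using that by (simp add: cyclic_heights_funpow_reroot H_def c_def M_def)
    have shift: "(\<lambda>i. j + i) ` {..<M} = {j..<j + M}"
      unfolding lessThan_atLeast0 image_add_atLeastLessThan by (simp add: add.commute)
    define m where "m = Min (g ` I)"
    have "(!) (cyclic_heights ((reroot ^^ j) t)) ` {..<M} = (\<lambda>i. H (j + i) - c) ` {..<M}"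
      by (rule image_cong) (auto simp: U_nth)
    also have "\<dots> = (\<lambda>r. H r - c) ` {j..<j + M}"
      by (simp add: shift[symmetric] image_image)
    also have "\<dots> = (\<lambda>r. H r - c) ` place ` I"
      using place_I by (simp add: bij_betw_def)
    also have "\<dots> = (\<lambda>v. v - c) ` g ` I"
      unfolding image_image by (rule image_cong) (auto simp: H_place)
    finally have "Min ((!) (cyclic_heights ((reroot ^^ j) t)) ` {..<M}) = Min ((\<lambda>v. v - c) ` g ` I)"
      by simp
    also have "\<dots> = m - c"
      unfolding m_def using p
      by (intro mono_Min_commute[symmetric]) (auto simp: mono_def I_def)
    finally have min: "Min ((!) (cyclic_heights ((reroot ^^ j) t)) ` {..<M}) = m - c" .
    have rel: "cum_labels_rel U k' = card {i \<in> I. g i < m + k'}" for k'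
    proof -
      have "cum_labels_rel U k' = card {i. i < M \<and> H (j + i) < m + k'}"
        using min by (auto simp: U_def cum_labels_rel_to_ltree nodes_funpow_reroot M_def[symmetric]
            U_nth intro!: arg_cong[of _ _ card])
      also have "\<dots> = card ((\<lambda>i. j + i) ` {i. i < M \<and> H (j + i) < m + k'})"
        by (simp add: card_image)
      also have "(\<lambda>i. j + i) ` {i. i < M \<and> H (j + i) < m + k'} = {r \<in> {j..<j + M}. H r < m + k'}"
        unfolding shift[symmetric] by auto
      also have "\<dots> = {r \<in> place ` I. H r < m + k'}"
        using place_I by (simp add: bij_betw_def)
      also have "\<dots> = place ` {i \<in> I. g i < m + k'}"
        by (auto simp: H_place)
      also have "card \<dots> = card {i \<in> I. g i < m + k'}"
        using place_I by (intro card_image) (auto simp: bij_betw_def inj_on_def)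
      finally show ?thesis .
    qed
    show "cum_labels_rel U (k - 2) \<le> cum_labels (to_ltree 1 t) k \<and>
        cum_labels (to_ltree 1 t) k \<le> cum_labels_rel U (k + 2)"
      unfolding W rel m_def I_def g_def
      by (intro conjI rerooted_distribution_bounds pos last step p k)
  qed
qed

section \<open>Conjugacy classes\<close>

definition conjugates :: "blossom \<Rightarrow> blossom set" where
  "conjugates t = (\<lambda>i. (reroot ^^ i) t) ` {..<nodes t + 2}"

text \<open>The finite form bounds the class size; the range form is closed under further
  rerooting.\<close>

lemma conjugates_eq_range: "conjugates t = range (\<lambda>i. (reroot ^^ i) t)"
proof -
  have "(reroot ^^ i) t \<in> conjugates t" for i
    using funpow_mod_eq[OF reroot_cycle, of i t]
    by (auto simp: conjugates_def intro!: image_eqI[of _ _ "i mod (nodes t + 2)"])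
  then show ?thesis
    by (auto simp: conjugates_def)
qed

lemma conjugates_refl: "t \<in> conjugates t"
  unfolding conjugates_eq_range by (metis funpow_0 rangeI)

lemma nodes_conjugates: "s \<in> conjugates t \<Longrightarrow> nodes s = nodes t"
  by (auto simp: conjugates_def nodes_funpow_reroot)

lemma conjugates_eqI:
  assumes "s \<in> conjugates t"
  shows "conjugates s = conjugates t"
proof -
  have sub: "conjugates s \<subseteq> conjugates t" if "s \<in> conjugates t" for s t
  proof -
    from that obtain i where "s = (reroot ^^ i) t"
      by (auto simp: conjugates_def)
    then have "(reroot ^^ j) s = (reroot ^^ (j + i)) t" for j
      by (simp add: funpow_add)
    then show ?thesis
      unfolding conjugates_eq_range by auto
  qed
  from assms obtain i where i: "i < nodes t + 2" "s = (reroot ^^ i) t"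
    by (auto simp: conjugates_def)
  \<comment> \<open>Symmetry: completing the cycle leads from \<open>s\<close> back to
    \<open>t\<close>.\<close>
  have "(reroot ^^ (nodes t + 2 - i)) s = (reroot ^^ (nodes t + 2 - i + i)) t"
    by (simp only: i(2) funpow_add comp_apply)
  also have "\<dots> = t"
    using i(1) reroot_cycle[of t] by simp
  finally have "t \<in> conjugates s"
    unfolding conjugates_eq_range by (metis rangeI)
  with assms sub show ?thesis by blast
qed

lemma partition_on_conjugates: "partition_on {t. nodes t = n} (conjugates ` {t. nodes t = n})"
proof (rule partition_onI)
  show "\<Union> (conjugates ` {t. nodes t = n}) = {t. nodes t = n}"
    using conjugates_refl by (fastforce dest: nodes_conjugates)
  show "{} \<notin> conjugates ` {t. nodes t = n}"
    using conjugates_refl by blast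
  fix p q assume "p \<in> conjugates ` {t. nodes t = n}" "q \<in> conjugates ` {t. nodes t = n}" "p \<noteq> q"
  then show "disjnt p q"
    by (auto simp: disjnt_iff dest: conjugates_eqI)
qed

lemma card_balanced_conjugates:
  "2 * card (conjugates t) = (nodes t + 2) * card {s \<in> conjugates t. balanced s}"
  using card_orbit[OF reroot_cycle, of t balanced]
  unfolding card_balanced_reroots conjugates_def .

theorem theorem2:
  fixes n :: nat
  assumes "n \<ge> 1"
  shows "\<exists>\<C>. partition_on (embedded_trees n) \<C> \<and>
           (\<forall>C\<in>\<C>.
              finite C \<and> card C \<le> n + 2 \<and>
              2 * card C = (n + 2) * card (C \<inter> well_labelled_trees n) \<and>
              (\<forall>W \<in> well_labelled_trees n \<inter> C. \<forall>U\<in>C. \<forall>k::int. k \<ge> 1 \<longrightarrow>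
                 cum_labels_rel U (k - 2) \<le> cum_labels W k \<and>
                 cum_labels W k \<le> cum_labels_rel U (k + 2)))"
proof -
  let ?\<C> = "(`) (to_ltree 1) ` conjugates ` {t. nodes t = n}"
  have inj: "inj (to_ltree 1)"
    by (rule injI) (rule to_ltree_inject)
  have "{} \<notin> ?\<C>"
    using conjugates_refl by blast
  then have partition: "partition_on (embedded_trees n) ?\<C>"
    using partition_on_inj_image[OF partition_on_conjugates, of "to_ltree 1" n] bij_betw_to_ltree[of n]
    by (simp add: bij_betw_def)
  show ?thesis
  proof (rule exI[of _ ?\<C>], intro conjI ballI allI impI)
    show "partition_on (embedded_trees n) ?\<C>"
      by (rule partition)
    fix C assume "C \<in> ?\<C>"
    then obtain t where t: "nodes t = n" and C: "C = to_ltree 1 ` conjugates t"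
      by auto
    show "finite C"
      by (simp add: C conjugates_def)
    have card: "card (to_ltree 1 ` A) = card A" for A
      using inj by (meson card_image inj_on_subset subset_UNIV)
    show "card C \<le> n + 2"
      unfolding C card conjugates_def t using card_image_le[of "{..<n + 2}"] by simp
    have "C \<inter> well_labelled_trees n = to_ltree 1 ` {s \<in> conjugates t. balanced s}"
      using t by (auto simp: C well_labelled_to_ltree nodes_conjugates)
    then show "2 * card C = (n + 2) * card (C \<inter> well_labelled_trees n)"
      using card_balanced_conjugates[of t] by (simp add: C card t)
    fix W U and k :: int
    assume W: "W \<in> well_labelled_trees n \<inter> C" and U: "U \<in> C" and k: "1 \<le> k"
    obtain w where w: "W = to_ltree 1 w" "w \<in> conjugates t" "balanced w"
      using W by (auto simp: C well_labelled_to_ltree)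
    \<comment> \<open>The class may be generated from \<open>w\<close>, so that \<open>U\<close> is
      a rerooting of the balanced tree itself.\<close>
    have "U \<in> to_ltree 1 ` conjugates w"
      using U conjugates_eqI[OF w(2)] by (simp add: C)
    then obtain j where "U = to_ltree 1 ((reroot ^^ j) w)" "j < nodes w + 2"
      by (auto simp: conjugates_def)
    then show "cum_labels_rel U (k - 2) \<le> cum_labels W k" "cum_labels W k \<le> cum_labels_rel U (k + 2)"
      using conjugate_distribution_bounds[OF w(3) _ k] w(1) by auto
  qed
qed

end
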